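(* Let $d=3$. There exists $p\in\mathbb{C}[T]$ satisfying $p(\boldsymbol{1})=1$ and the sub-QMF condition $$1-\sum_{\sigma\in G}p^{\sigma*}p^{\sigma}\ge0\quad\text{on }\mathbb{T}^3,$$ such that $1-p^*p$ is not a sum of hermitian squares in $\mathbb{R}[T]$.
   Context: $M\in\mathbb{Z}^{3\times3}$ is an expansive matrix (all eigenvalues are strictly larger than $1$ in modulus), and $G=2\pi M^{-T}\mathbb{Z}^3/2\pi\mathbb{Z}^3$ is the associated finite abelian group of order $|\det M|$. $\mathbb{C}[T]=\mathbb{C}[z_1^{\pm1},z_2^{\pm1},z_3^{\pm1}]$ is the ring of complex Laurent polynomials, with the involution $*$ given by $z_j^*=z_j^{-1}$ and complex conjugation on coefficients; $\mathbb{R}[T]$ is the subring of $*$-invariant elements of $\mathbb{C}[T]$. Laurent polynomials are identified with trigonometric polynomials via $z=\boldsymbol{e}^{-i\omega}=(e^{-i\omega_1},e^{-i\omega_2},e^{-i\omega_3})$, $\omega\in\mathbb{R}^3$. $\boldsymbol{1}=(1,1,1)$ and $\mathbb{T}^3=\{z\in\mathbb{C}^3:|z_1|=|z_2|=|z_3|=1\}$. For $p\in\mathbb{C}[T]$ and $\sigma\in G$, $p^\sigma$ is defined by $p^\sigma(\boldsymbol{e}^{-i\omega})=p(\boldsymbol{e}^{-i(\omega+\sigma)})$, and $p^{\sigma*}=(p^\sigma)^*$. An element $f$ is called a sum of hermitian squares if there exist finitely many $h_1,\dots,h_r\in\mathbb{C}[T]$ with $f=\sum_{j=1}^r h_j^*h_j$.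 *)

theory Defs
  imports "HOL-Analysis.Analysis" "HOL-Library.Poly_Mapping" "HOL-Library.Nonpos_Ints"
begin

section \<open>Laurent polynomials\<close>

text \<open>The group algebra of the additive group of integer exponent vectors: the key \<open>k\<close> stands for
  the monomial \<open>z\<^sub>1 powi k\<^sub>1 * z\<^sub>2 powi k\<^sub>2 * z\<^sub>3 powi k\<^sub>3\<close>, and multiplication is convolution.\<close>

type_synonym laurent = "(int ^ 3) \<Rightarrow>\<^sub>0 complex"

definition laurent_eval :: "laurent \<Rightarrow> complex ^ 3 \<Rightarrow> complex" where
  "laurent_eval p z =
     (\<Sum>k\<in>Poly_Mapping.keys p. Poly_Mapping.lookup p k * (\<Prod>j\<in>UNIV. z $ j powi k $ j))"

lift_definition laurent_star :: "laurent \<Rightarrow> laurent" is "\<lambda>p k. cnj (p (- k))"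
proof -
  fix p :: "int ^ 3 \<Rightarrow> complex"
  assume "finite {k. p k \<noteq> 0}"
  moreover have "{k. cnj (p (- k)) \<noteq> 0} = uminus ` {k. p k \<noteq> 0}"
    by (auto simp: image_iff intro!: exI[of _ "- _"])
  ultimately show "finite {k. cnj (p (- k)) \<noteq> 0}" by simp
qed

lemma lookup_laurent_star:
  "Poly_Mapping.lookup (laurent_star p) k = cnj (Poly_Mapping.lookup p (- k))"
  by transfer simp

text \<open>Each \<open>h\<^sup>* h\<close> is invariant under the involution, so such sums lie in the real subring
  automatically.\<close>

definition sum_hermitian_squares :: "laurent \<Rightarrow> bool" where
  "sum_hermitian_squares f \<longleftrightarrow>
     (\<exists>(r::nat) h. f = (\<Sum>j<r. laurent_star (h j) * h j))"

definition torus3 :: "(complex ^ 3) set" where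
  "torus3 = {z. \<forall>j. cmod (z $ j) = 1}"


section \<open>Trigonometric polynomials\<close>

definition exp_vec :: "real ^ 3 \<Rightarrow> complex ^ 3" where
  "exp_vec \<omega> = (\<chi> j. exp (- (\<i> * of_real (\<omega> $ j))))"

lemma range_exp_vec: "range exp_vec = torus3"
proof (intro equalityI subsetI)
  fix z assume "z \<in> torus3"
  then have "cmod (z $ j) = 1" for j by (simp add: torus3_def)
  then have "cis (Arg (z $ j)) = z $ j" for j
    by (metis cis_Arg div_by_1 norm_zero of_real_1 sgn_eq zero_neq_one)
  then have "exp (- (\<i> * of_real (- Arg (z $ j)))) = z $ j" for j
    by (simp add: cis_conv_exp)
  then have "z = exp_vec (\<chi> j. - Arg (z $ j))"
    by (simp add: exp_vec_def vec_eq_iff)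
  then show "z \<in> range exp_vec" by blast
qed (auto simp: exp_vec_def torus3_def)

definition int_dot :: "int ^ 3 \<Rightarrow> real ^ 3 \<Rightarrow> real" where
  "int_dot k \<omega> = (\<Sum>j\<in>UNIV. of_int (k $ j) * \<omega> $ j)"

lemma int_dot_add: "int_dot k (x + y) = int_dot k x + int_dot k y"
  by (simp add: int_dot_def distrib_left sum.distrib)

lemma exp_vec_monom:
  "(\<Prod>j\<in>UNIV. exp_vec \<omega> $ j powi k $ j) = exp (- (\<i> * of_real (int_dot k \<omega>)))"
proof -
  have 1: "exp_vec \<omega> $ j powi k $ j = exp (- (\<i> * of_real (of_int (k $ j) * \<omega> $ j)))" for j
    by (simp add: exp_vec_def exp_power_int algebra_simps)
  have "- (\<i> * of_real (int_dot k \<omega>))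
      = (\<Sum>j\<in>UNIV. - (\<i> * of_real (of_int (k $ j) * \<omega> $ j)))"
    by (simp add: int_dot_def sum_negf sum_distrib_left)
  then show ?thesis by (simp only: 1 exp_sum[OF finite_class.finite_UNIV])
qed

lemma laurent_eval_superset:
  assumes "finite A" "Poly_Mapping.keys p \<subseteq> A"
  shows "laurent_eval p z = (\<Sum>k\<in>A. Poly_Mapping.lookup p k * (\<Prod>j\<in>UNIV. z $ j powi k $ j))"
  unfolding laurent_eval_def
  by (rule sum.mono_neutral_left) (use assms in \<open>auto simp: in_keys_iff\<close>)

lemma characters_independent:
  assumes "finite A" "\<And>\<omega>. (\<Sum>k\<in>A. c k * exp (- (\<i> * of_real (int_dot k \<omega>)))) = 0" "k \<in> A"
  shows "c k = 0"
  using assms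
proof (induction A arbitrary: c k rule: finite_induct)
  case empty
  then show ?case by simp
next
  case (insert a A)
  let ?e = "\<lambda>k \<omega>. exp (- (\<i> * of_real (int_dot k \<omega>)))"
  have e_add: "?e k (x + y) = ?e k x * ?e k y" for k x y
    by (simp add: int_dot_add algebra_simps flip: exp_add)
  have zero: "c b = 0" if b: "b \<in> A" for b
  proof -
    obtain j where j: "a $ j \<noteq> b $ j" using b insert.hyps by (metis vec_eq_iff)
    define y :: "real ^ 3" where "y = axis j (pi / of_int (a $ j - b $ j))"
    have idot: "int_dot k y = of_int (k $ j) * (pi / of_int (a $ j - b $ j))" for k
      unfolding int_dot_def y_def
      by (subst sum.remove[of _ j]) (auto simp: axis_def intro!: sum.neutral)
    have "int_dot a y - int_dot b y = pi"
      using j unfolding idot left_diff_distrib[symmetric] of_int_diff[symmetric] by simp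
    then have "int_dot a y = int_dot b y + pi" by simp
    then have "?e a y = ?e b y * exp (- (\<i> * of_real pi))"
      by (simp add: algebra_simps flip: exp_add)
    then have eab: "?e a y = - ?e b y" by (simp add: exp_minus)
    have "(\<Sum>k\<in>A. (c k * (?e k y - ?e a y)) * ?e k \<omega>) = 0" for \<omega>
    proof -
      have 1: "c a * ?e a (\<omega> + y) + (\<Sum>k\<in>A. c k * ?e k (\<omega> + y)) = 0"
        using insert.prems(1)[of "\<omega> + y"] insert.hyps by simp
      have 2: "c a * ?e a \<omega> + (\<Sum>k\<in>A. c k * ?e k \<omega>) = 0"
        using insert.prems(1)[of \<omega>] insert.hyps by simp
      have "(\<Sum>k\<in>A. (c k * (?e k y - ?e a y)) * ?e k \<omega>)
          = (\<Sum>k\<in>A. c k * ?e k (\<omega> + y)) - ?e a y * (\<Sum>k\<in>A. c k * ?e k \<omega>)"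
        unfolding e_add sum_distrib_left sum_subtractf[symmetric]
        by (rule sum.cong) (auto simp: algebra_simps)
      also have "\<dots> = - (c a * ?e a (\<omega> + y)) - ?e a y * (- (c a * ?e a \<omega>))"
        using 1 2 by (simp add: add_eq_0_iff)
      also have "\<dots> = 0" unfolding e_add by (simp add: algebra_simps)
      finally show ?thesis .
    qed
    from insert.IH[of "\<lambda>k. c k * (?e k y - ?e a y)", OF this b] eab show ?thesis by auto
  qed
  have "c a * ?e a 0 + (\<Sum>k\<in>A. c k * ?e k 0) = 0"
    using insert.prems(1)[of 0] insert.hyps by simp
  with zero have "c a = 0" by simp
  with zero insert.prems show ?case by auto
qed

text \<open>Laurent polynomials may be identified with trigonometric polynomials.\<close>

lemma laurent_eqI:
  assumes "\<And>\<omega>. laurent_eval p (exp_vec \<omega>) = laurent_eval q (exp_vec \<omega>)"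
  shows "p = q"
proof (rule poly_mapping_eqI)
  fix k
  let ?A = "insert k (Poly_Mapping.keys p \<union> Poly_Mapping.keys q)"
  have "Poly_Mapping.lookup p k - Poly_Mapping.lookup q k = 0"
  proof (rule characters_independent[of ?A])
    show "(\<Sum>k\<in>?A. (Poly_Mapping.lookup p k - Poly_Mapping.lookup q k) *
        exp (- (\<i> * of_real (int_dot k \<omega>)))) = 0" for \<omega>
      using assms[of \<omega>] laurent_eval_superset[of ?A p "exp_vec \<omega>"]
        laurent_eval_superset[of ?A q "exp_vec \<omega>"]
      unfolding left_diff_distrib sum_subtractf exp_vec_monom by (simp add: subset_insertI2)
  qed auto
  then show "Poly_Mapping.lookup p k = Poly_Mapping.lookup q k" by simp
qed


section \<open>The dilation matrix and its group\<close>

definition expansive :: "int ^ 3 ^ 3 \<Rightarrow> bool" where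
  "expansive M \<longleftrightarrow>
     (\<forall>(\<mu>::complex) v. v \<noteq> 0 \<and> map_matrix of_int M *v v = \<mu> *s v \<longrightarrow> 1 < cmod \<mu>)"

definition two_pi_lattice :: "(real ^ 3) set" where
  "two_pi_lattice = range (\<lambda>k :: int ^ 3. \<chi> j. 2 * pi * of_int (k $ j))"

definition fine_lattice :: "int ^ 3 ^ 3 \<Rightarrow> (real ^ 3) set" where
  "fine_lattice M =
     (\<lambda>x. matrix_inv (transpose (map_matrix of_int M)) *v x) ` two_pi_lattice"

definition lattice_rel :: "int ^ 3 ^ 3 \<Rightarrow> ((real ^ 3) \<times> (real ^ 3)) set" where
  "lattice_rel M =
     {(x, y). x \<in> fine_lattice M \<and> y \<in> fine_lattice M \<and> x - y \<in> two_pi_lattice}"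

definition dual_group :: "int ^ 3 ^ 3 \<Rightarrow> (real ^ 3) set set" where
  "dual_group M = fine_lattice M // lattice_rel M"

text \<open>\<open>\<sigma>\<close> is a coset; the value does not depend on the representative \<open>s\<close>,
  see \<open>laurent_shift_eqI\<close> below.\<close>

definition laurent_shift :: "(real ^ 3) set \<Rightarrow> laurent \<Rightarrow> laurent" where
  "laurent_shift \<sigma> p =
     (THE q. \<forall>s\<in>\<sigma>. \<forall>\<omega>. laurent_eval q (exp_vec \<omega>) = laurent_eval p (exp_vec (\<omega> + s)))"

lemma exp_vec_periodic:
  assumes "x - y \<in> two_pi_lattice"
  shows "exp_vec (\<omega> + x) = exp_vec (\<omega> + y)"
proof -
  obtain k :: "int ^ 3" where "x - y = (\<chi> j. 2 * pi * of_int (k $ j))"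
    using assms by (auto simp: two_pi_lattice_def)
  then have *: "x $ j = y $ j + 2 * pi * of_int (k $ j)" for j
    by (metis (no_types, lifting) add.commute diff_add_cancel vec_lambda_beta vector_minus_component)
  have "exp (- (\<i> * of_real ((\<omega> + x) $ j))) = exp (- (\<i> * of_real ((\<omega> + y) $ j)))" for j
    unfolding exp_eq by (intro exI[of _ "- (k $ j)"]) (simp add: * algebra_simps)
  then show ?thesis by (simp add: exp_vec_def vec_eq_iff)
qed

lemma zero_in_two_pi_lattice: "0 \<in> two_pi_lattice"
  unfolding two_pi_lattice_def by (rule range_eqI[of _ _ 0]) (simp add: vec_eq_iff)

lemma uminus_two_pi_lattice:
  assumes "x \<in> two_pi_lattice"
  shows "- x \<in> two_pi_lattice"
proof -
  obtain k :: "int ^ 3" where "x = (\<chi> j. 2 * pi * of_int (k $ j))"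
    using assms by (auto simp: two_pi_lattice_def)
  then show ?thesis
    unfolding two_pi_lattice_def by (intro range_eqI[of _ _ "- k"]) (simp add: vec_eq_iff)
qed

lemma add_two_pi_lattice:
  assumes "x \<in> two_pi_lattice" "y \<in> two_pi_lattice"
  shows "x + y \<in> two_pi_lattice"
proof -
  obtain k l :: "int ^ 3" where
    "x = (\<chi> j. 2 * pi * of_int (k $ j))" "y = (\<chi> j. 2 * pi * of_int (l $ j))"
    using assms by (auto simp: two_pi_lattice_def)
  then show ?thesis
    unfolding two_pi_lattice_def
    by (intro range_eqI[of _ _ "k + l"]) (simp add: vec_eq_iff algebra_simps)
qed

lemma equiv_lattice_rel: "equiv (fine_lattice M) (lattice_rel M)"
proof (rule equivI)
  show "lattice_rel M \<subseteq> fine_lattice M \<times> fine_lattice M"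
    by (auto simp: lattice_rel_def)
  show "refl_on (fine_lattice M) (lattice_rel M)"
    by (auto simp: refl_on_def lattice_rel_def zero_in_two_pi_lattice)
  show "sym (lattice_rel M)"
    unfolding sym_def lattice_rel_def using uminus_two_pi_lattice by fastforce
  show "trans (lattice_rel M)"
    unfolding trans_def lattice_rel_def
    using add_two_pi_lattice
    by (clarsimp; metis (no_types, lifting) add_diff_eq diff_add_cancel)
qed

text \<open>Existence and uniqueness of the Laurent polynomial described by \<open>laurent_shift\<close>.\<close>

lemma laurent_shift_eqI:
  assumes "\<sigma> \<in> dual_group M" "s \<in> \<sigma>"
    and "\<And>\<omega>. laurent_eval q (exp_vec \<omega>) = laurent_eval p (exp_vec (\<omega> + s))"
  shows "laurent_shift \<sigma> p = q"
proof -
  have "s - t \<in> two_pi_lattice" if "t \<in> \<sigma>" for t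
    using quotient_eq_iff[OF equiv_lattice_rel, of \<sigma> M \<sigma> s t] assms that
    by (auto simp: dual_group_def lattice_rel_def)
  then have "exp_vec (\<omega> + s) = exp_vec (\<omega> + t)" if "t \<in> \<sigma>" for t \<omega>
    using that exp_vec_periodic by blast
  then have *: "laurent_eval q (exp_vec \<omega>) = laurent_eval p (exp_vec (\<omega> + t))"
    if "t \<in> \<sigma>" for t \<omega>
    using that assms(3) by simp
  show ?thesis
    unfolding laurent_shift_def
  proof (rule the_equality)
    show "\<forall>t\<in>\<sigma>. \<forall>\<omega>. laurent_eval q (exp_vec \<omega>) = laurent_eval p (exp_vec (\<omega> + t))"
      using * by blast
  next
    fix q'
    assume "\<forall>t\<in>\<sigma>. \<forall>\<omega>. laurent_eval q' (exp_vec \<omega>) = laurent_eval p (exp_vec (\<omega> + t))"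
    then have "laurent_eval q' (exp_vec \<omega>) = laurent_eval q (exp_vec \<omega>)" for \<omega>
      using assms(2,3) by simp
    then show "q' = q" by (rule laurent_eqI)
  qed
qed

lemma lookup_laurent_shift:
  assumes "\<sigma> \<in> dual_group M" "s \<in> \<sigma>"
  shows "Poly_Mapping.lookup (laurent_shift \<sigma> p) k =
    Poly_Mapping.lookup p k * exp (- (\<i> * of_real (int_dot k s)))"
proof -
  let ?f = "\<lambda>k. Poly_Mapping.lookup p k * exp (- (\<i> * of_real (int_dot k s)))"
  define q where "q = Abs_poly_mapping ?f"
  have set: "{k. ?f k \<noteq> 0} = Poly_Mapping.keys p" by (auto simp: in_keys_iff)
  then have "finite {k. ?f k \<noteq> 0}" by simp
  then have lq: "Poly_Mapping.lookup q = ?f" unfolding q_def by (rule lookup_Abs_poly_mapping)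
  then have kq: "Poly_Mapping.keys q = Poly_Mapping.keys p" by (auto simp: in_keys_iff)
  have "laurent_eval q (exp_vec \<omega>) = laurent_eval p (exp_vec (\<omega> + s))" for \<omega>
    unfolding laurent_eval_def kq lq exp_vec_monom int_dot_add
    by (rule sum.cong) (simp_all add: algebra_simps flip: exp_add)
  from laurent_shift_eqI[OF assms this] lq show ?thesis by simp
qed

lemma expansive_det:
  assumes "expansive M"
  shows "det M \<noteq> 0"
proof
  assume "det M = 0"
  then have "det (map_matrix of_int M :: complex ^ 3 ^ 3) = of_int 0"
    unfolding det_3 by (simp flip: of_int_mult of_int_add of_int_diff del: of_int_0)
  then have "\<not> invertible (map_matrix of_int M :: complex ^ 3 ^ 3)"
    by (simp add: invertible_det_nz)
  then obtain v :: "complex ^ 3" where "v \<noteq> 0" "map_matrix of_int M *v v = 0"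
    by (metis invertible_left_inverse matrix_left_invertible_ker)
  then have "1 < cmod 0"
    using assms unfolding expansive_def by (metis vector_smult_lzero)
  then show False by simp
qed

text \<open>The sums over the group are genuine finite sums.\<close>

lemma finite_dual_group:
  assumes "expansive M"
  shows "finite (dual_group M)"
proof -
  define A :: "real ^ 3 ^ 3" where "A = transpose (map_matrix of_int M)"
  define D where "D = det M"
  have D: "D \<noteq> 0" using expansive_det[OF assms] by (simp add: D_def)
  have detA: "det A = of_int D"
    unfolding A_def D_def det_transpose unfolding det_3 by simp
  have int: "\<exists>n :: int ^ 3. \<forall>j. x $ j = 2 * pi * of_int (n $ j) / of_int D"
    if x: "x \<in> fine_lattice M" for x
  proof -
    obtain k :: "int ^ 3" where k: "x = matrix_inv A *v (\<chi> j. 2 * pi * of_int (k $ j))"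
      using x by (auto simp: fine_lattice_def two_pi_lattice_def A_def)
    have "invertible A" by (simp add: invertible_det_nz detA D)
    then have "A ** matrix_inv A = mat 1"
      unfolding invertible_def matrix_inv_def by (rule someI2_ex) blast
    then have Ax: "A *v x = (\<chi> j. 2 * pi * of_int (k $ j))"
      by (simp add: k matrix_vector_mul_assoc)
    define n :: "int ^ 3" where
      "n = (\<chi> l. det ((\<chi> i j. if j = l then k $ i else transpose M $ i $ j) :: int ^ 3 ^ 3))"
    have "x = (\<chi> l. det (\<chi> i j. if j = l then (\<chi> j. 2 * pi * of_int (k $ j)) $ i else A $ i $ j) / det A)"
      by (rule iffD1[OF cramer Ax]) (simp add: detA D)
    moreover have "det (\<chi> i j. if j = l then (\<chi> j. 2 * pi * of_int (k $ j)) $ i else A $ i $ j)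
        = 2 * pi * of_int (n $ l)" for l
      using exhaust_3[of l] unfolding n_def det_3
      by (auto simp: A_def transpose_def algebra_simps)
    ultimately have "\<forall>j. x $ j = 2 * pi * of_int (n $ j) / of_int D"
      by (simp add: detA vec_eq_iff)
    then show ?thesis by blast
  qed
  then obtain N :: "real ^ 3 \<Rightarrow> int ^ 3" where
    N: "\<And>x j. x \<in> fine_lattice M \<Longrightarrow> x $ j = 2 * pi * of_int (N x $ j) / of_int D"
    by metis
  define h where "h x = (\<lambda>j\<in>(UNIV::3 set). N x $ j mod D)" for x
  have "h ` fine_lattice M \<subseteq> (UNIV::3 set) \<rightarrow>\<^sub>E {- \<bar>D\<bar>..\<bar>D\<bar>}"
    using D by (auto simp: h_def) (smt (verit) abs_mod_less)+
  then have fin: "finite (h ` fine_lattice M)"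
    by (rule finite_subset) (auto intro!: finite_PiE)
  have rel: "(x, y) \<in> lattice_rel M"
    if xy: "x \<in> fine_lattice M" "y \<in> fine_lattice M" "h x = h y" for x y
  proof -
    have "N x $ j mod D = N y $ j mod D" for j
      using fun_cong[OF xy(3), of j] by (simp add: h_def)
    then have "\<exists>m. N x $ j = N y $ j + D * m" for j
      by (metis mod_eqE)
    then obtain m where m: "\<And>j. N x $ j = N y $ j + D * m j" by metis
    have "x - y = (\<chi> j. 2 * pi * of_int ((\<chi> j. m j) $ j))"
      using D by (simp add: vec_eq_iff N[OF xy(1)] N[OF xy(2)] m field_simps)
    then show ?thesis using xy unfolding lattice_rel_def two_pi_lattice_def by blast
  qed
  let ?g = "\<lambda>n. lattice_rel M `` {SOME x. x \<in> fine_lattice M \<and> h x = n}"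
  have "dual_group M \<subseteq> ?g ` (h ` fine_lattice M)"
  proof
    fix \<sigma> assume "\<sigma> \<in> dual_group M"
    then obtain x where x: "x \<in> fine_lattice M" "\<sigma> = lattice_rel M `` {x}"
      by (auto simp: dual_group_def quotient_def)
    define y where "y = (SOME y. y \<in> fine_lattice M \<and> h y = h x)"
    have "y \<in> fine_lattice M \<and> h y = h x"
      unfolding y_def by (rule someI[of _ x]) (simp add: x)
    then have "\<sigma> = lattice_rel M `` {y}"
      using x rel equiv_class_eq[OF equiv_lattice_rel] by metis
    then show "\<sigma> \<in> ?g ` (h ` fine_lattice M)" using x y_def by blast
  qed
  then show ?thesis using fin by (meson finite_imageI finite_subset)
qed

end

theory Submission
  imports Defs
begin

text \<open>
  A Laurent polynomial is identified with the trigonometric polynomial \<open>\<omega> \<mapsto> p (exp (- i \<omega>))\<close>, and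
  the obstruction to being a sum of hermitian squares is read off from the Taylor expansion at
  \<open>\<omega> = 0\<close>. If \<open>1 - p\<^sup>* p\<close> starts there with a positive multiple of the Motzkin form
  \<open>x\<^sup>4 y\<^sup>2 + x\<^sup>2 y\<^sup>4 + z\<^sup>6 - 3 x\<^sup>2 y\<^sup>2 z\<^sup>2\<close>, then every \<open>h\<close> with \<open>|h|\<^sup>2 \<le> 1 - |p|\<^sup>2\<close> has no terms of
  degree below \<open>3\<close>, and its cubic part \<open>L\<close> is such that \<open>|L|\<^sup>2\<close> is bounded by a multiple of the
  Motzkin form. The zeros of the Motzkin form
  force \<open>L (0, 0, 1) = 0\<close> (\<open>cubic_below_motzkin\<close>). In a representation
  \<open>1 - |p|\<^sup>2 = \<Sum> |h\<^sub>j|\<^sup>2\<close> every summand is therefore of smaller order than \<open>t\<^sup>6\<close> along the ray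
  \<open>\<omega> = (0, 0, t)\<close>, although the left-hand side is of the exact order \<open>t\<^sup>6\<close>
  (\<open>not_sum_hermitian_squares_if_motzkin\<close>).

  It remains to find such a \<open>p\<close> that also satisfies the sub-QMF condition. The factor
  \<open>1 - motzkin (sin \<omega>\<^sub>1) (sin \<omega>\<^sub>2) (sin \<omega>\<^sub>3) / 3\<close> takes values in \<open>[0, 1]\<close> and has the right
  expansion. It is multiplied by a trigonometric polynomial \<open>H\<close> with values in \<open>[0, 1]\<close> for which
  \<open>1 - H\<close> vanishes at \<open>0\<close> to order at least \<open>7\<close>, so that the terms of degree \<open>6\<close> are unaffected,
  and for which the shifts of \<open>H\<close> by \<open>G\<close> add up to at most \<open>1\<close>. As the values lie in \<open>[0, 1]\<close>, the
  squares of the shifts of the product then also add up to at most \<open>1\<close>.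

  For \<open>H\<close>, start with the product \<open>f\<close> of three Fejer kernels of length \<open>N = |det M|\<close>. Its shifts by
  the grid \<open>2 \<pi> \<int>\<^sup>3 / N\<close> modulo \<open>2 \<pi> \<int>\<^sup>3\<close> form a partition of unity, and by Cramer's rule \<open>G\<close> lies in
  this grid. Then put \<open>H = 1 - (1 - f\<^sup>1\<^sup>4)\<^sup>7\<close>. This makes \<open>H\<close> flat at \<open>0\<close>, and the
  sum over the shifts stays below \<open>1\<close> because at most one of several nonnegative numbers with sum at
  most \<open>1\<close> exceeds \<open>1 / 2\<close>, and the high powers of the others are negligible
  (\<open>sum_plateau_le_1\<close>).
\<close>

section \<open>Laurent polynomials as functions of the frequency\<close>

abbreviation trig :: "laurent \<Rightarrow> real ^ 3 \<Rightarrow> complex" where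
  "trig p \<omega> \<equiv> laurent_eval p (exp_vec \<omega>)"

definition character :: "int ^ 3 \<Rightarrow> real ^ 3 \<Rightarrow> complex" where
  "character k \<omega> = exp (- (\<i> * of_real (int_dot k \<omega>)))"

lemma character_add: "character (k + l) \<omega> = character k \<omega> * character l \<omega>"
  by (simp add: character_def int_dot_def distrib_right sum.distrib algebra_simps flip: exp_add)

lemma character_0 [simp]: "character 0 \<omega> = 1"
  by (simp add: character_def int_dot_def)

lemma cnj_character: "cnj (character k \<omega>) = character (- k) \<omega>"
  by (simp add: character_def int_dot_def sum_negf exp_cnj)

lemma character_axis: "character (axis j m) \<omega> = exp (- (\<i> * of_real (of_int m * \<omega> $ j)))"
proof -
  have "int_dot (axis j m) \<omega> = of_int m * \<omega> $ j"
    unfolding int_dot_def by (subst sum.remove[of _ j]) (auto simp: axis_def intro!: sum.neutral)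
  then show ?thesis by (simp add: character_def)
qed

lemma trig_superset:
  assumes "finite A" "Poly_Mapping.keys p \<subseteq> A"
  shows "trig p \<omega> = (\<Sum>k\<in>A. Poly_Mapping.lookup p k * character k \<omega>)"
  unfolding laurent_eval_superset[OF assms] exp_vec_monom character_def ..

lemma trig_eq: "trig p \<omega> = (\<Sum>k\<in>Poly_Mapping.keys p. Poly_Mapping.lookup p k * character k \<omega>)"
  by (rule trig_superset) auto

lemma trig_0 [simp]: "trig 0 \<omega> = 0"
  by (simp add: trig_eq)

lemma trig_single: "trig (Poly_Mapping.single k c) \<omega> = c * character k \<omega>"
  by (subst trig_superset[of "{k}"]) auto

lemma trig_1 [simp]: "trig 1 \<omega> = 1"
  using trig_single[of 0 1 \<omega>] by simp

lemma trig_add: "trig (p + q) \<omega> = trig p \<omega> + trig q \<omega>"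
proof -
  let ?A = "Poly_Mapping.keys p \<union> Poly_Mapping.keys q"
  have "Poly_Mapping.keys (p + q) \<subseteq> ?A" by (rule keys_add)
  then show ?thesis
    by (simp add: trig_superset[of ?A] lookup_add distrib_right sum.distrib)
qed

lemma trig_diff: "trig (p - q) \<omega> = trig p \<omega> - trig q \<omega>"
  using trig_add[of "p - q" q \<omega>] by simp

lemma trig_sum: "trig (\<Sum>i\<in>I. p i) \<omega> = (\<Sum>i\<in>I. trig (p i) \<omega>)"
  by (induction I rule: infinite_finite_induct) (auto simp: trig_add)

lemma laurent_eq_sum_single:
  fixes p :: laurent
  shows "p = (\<Sum>k\<in>Poly_Mapping.keys p. Poly_Mapping.single k (Poly_Mapping.lookup p k))"
proof (rule poly_mapping_eqI)
  fix l
  show "Poly_Mapping.lookup p l =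
    Poly_Mapping.lookup (\<Sum>k\<in>Poly_Mapping.keys p. Poly_Mapping.single k (Poly_Mapping.lookup p k)) l"
    by (auto simp: lookup_sum lookup_single when_def in_keys_iff)
qed

lemma trig_mult: "trig (p * q) \<omega> = trig p \<omega> * trig q \<omega>"
proof -
  have "p * q = (\<Sum>k\<in>Poly_Mapping.keys p. \<Sum>l\<in>Poly_Mapping.keys q.
      Poly_Mapping.single (k + l) (Poly_Mapping.lookup p k * Poly_Mapping.lookup q l))"
    by (subst laurent_eq_sum_single[of p], subst laurent_eq_sum_single[of q])
      (simp add: sum_product mult_single)
  then show ?thesis
    by (simp only: trig_sum trig_single character_add trig_eq[of p] trig_eq[of q] sum_product)
      (simp add: mult_ac)
qed

lemma trig_star: "trig (laurent_star p) \<omega> = cnj (trig p \<omega>)"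
proof -
  have *: "Poly_Mapping.keys (laurent_star p) = uminus ` Poly_Mapping.keys p"
    by (auto simp: in_keys_iff lookup_laurent_star image_iff intro!: bexI[of _ "- _"])
  show ?thesis
    unfolding trig_eq *
    by (subst sum.reindex) (auto simp: lookup_laurent_star cnj_character)
qed

lemma trig_shift:
  assumes "\<sigma> \<in> dual_group M" "s \<in> \<sigma>"
  shows "trig (laurent_shift \<sigma> p) \<omega> = trig p (\<omega> + s)"
proof -
  have "Poly_Mapping.keys (laurent_shift \<sigma> p) = Poly_Mapping.keys p"
    using lookup_laurent_shift[OF assms, of p] by (auto simp: in_keys_iff)
  then show ?thesis
    by (simp add: trig_eq lookup_laurent_shift[OF assms] character_def int_dot_add
        algebra_simps flip: exp_add)
qed

definition is_trig :: "(real ^ 3 \<Rightarrow> complex) \<Rightarrow> bool" where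
  "is_trig g \<longleftrightarrow> (\<exists>p. \<forall>\<omega>. trig p \<omega> = g \<omega>)"

named_theorems is_trig_intros

text \<open>The closure properties below allow a Laurent polynomial to be specified by its values
  alone; no coefficients have to be computed.\<close>

lemma is_trig_character [is_trig_intros]: "is_trig (character k)"
  unfolding is_trig_def by (rule exI[of _ "Poly_Mapping.single k 1"]) (simp add: trig_single)

lemma is_trig_const [is_trig_intros]: "is_trig (\<lambda>_. c)"
  unfolding is_trig_def by (rule exI[of _ "Poly_Mapping.single 0 c"]) (simp add: trig_single)

lemma is_trig_add [is_trig_intros]: "is_trig f \<Longrightarrow> is_trig g \<Longrightarrow> is_trig (\<lambda>\<omega>. f \<omega> + g \<omega>)"
  unfolding is_trig_def by (metis trig_add)

lemma is_trig_diff [is_trig_intros]: "is_trig f \<Longrightarrow> is_trig g \<Longrightarrow> is_trig (\<lambda>\<omega>. f \<omega> - g \<omega>)"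
  unfolding is_trig_def by (metis trig_diff)

lemma is_trig_mult [is_trig_intros]: "is_trig f \<Longrightarrow> is_trig g \<Longrightarrow> is_trig (\<lambda>\<omega>. f \<omega> * g \<omega>)"
  unfolding is_trig_def by (metis trig_mult)

lemma is_trig_cnj [is_trig_intros]: "is_trig f \<Longrightarrow> is_trig (\<lambda>\<omega>. cnj (f \<omega>))"
  unfolding is_trig_def by (metis trig_star)

lemma is_trig_power [is_trig_intros]: "is_trig f \<Longrightarrow> is_trig (\<lambda>\<omega>. f \<omega> ^ n)"
  by (induction n) (auto intro: is_trig_intros)

lemma is_trig_sum [is_trig_intros]: "(\<And>i. i \<in> I \<Longrightarrow> is_trig (f i)) \<Longrightarrow> is_trig (\<lambda>\<omega>. \<Sum>i\<in>I. f i \<omega>)"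
  by (induction I rule: infinite_finite_induct) (auto intro: is_trig_intros)

lemma is_trig_prod [is_trig_intros]: "(\<And>i. i \<in> I \<Longrightarrow> is_trig (f i)) \<Longrightarrow> is_trig (\<lambda>\<omega>. \<Prod>i\<in>I. f i \<omega>)"
  by (induction I rule: infinite_finite_induct) (auto intro: is_trig_intros)

lemma is_trig_sin [is_trig_intros]: "is_trig (\<lambda>\<omega>. of_real (sin (\<omega> $ j)))"
proof -
  have "complex_of_real (sin (\<omega> $ j)) =
      (character (axis j (-1)) \<omega> - character (axis j 1) \<omega>) * (1 / (2 * \<i>))" for \<omega>
    by (simp add: character_axis sin_of_real[symmetric] sin_exp_eq)
  then show ?thesis by (simp only:) (intro is_trig_intros)
qed

section \<open>Expansion along rays\<close>

text \<open>The coefficient of \<open>t\<^sup>n\<close> in the Taylor expansion of \<open>t \<mapsto> h (t v)\<close> at \<open>0\<close>. As a function of \<open>v\<close>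
  it is a form of degree \<open>n\<close>, because \<open>int_dot k v\<close> is linear in \<open>v\<close>.\<close>

definition ray_coeff :: "laurent \<Rightarrow> real ^ 3 \<Rightarrow> nat \<Rightarrow> complex" where
  "ray_coeff h v n = (\<Sum>k\<in>Poly_Mapping.keys h.
     Poly_Mapping.lookup h k * (- (\<i> * of_real (int_dot k v))) ^ n / fact n)"

text \<open>Only finitely many exponentials \<open>exp (- i t (k \<bullet> v))\<close> occur, so their Taylor remainders, each of
  order \<open>t\<^sup>d\<^sup>+\<^sup>1\<close>, add up to a remainder of the same order.\<close>

lemma trig_ray_expansion:
  "((\<lambda>t. (trig h (t *\<^sub>R v) - (\<Sum>n\<le>d. ray_coeff h v n * of_real t ^ n)) / of_real t ^ d)
     \<longlongrightarrow> 0) (at_right 0)"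
proof -
  let ?K = "Poly_Mapping.keys h" and ?c = "Poly_Mapping.lookup h"
  let ?C = "\<Sum>k\<in>?K. cmod (?c k) * \<bar>int_dot k v\<bar> ^ Suc d / fact d"
  let ?r = "\<lambda>t. trig h (t *\<^sub>R v) - (\<Sum>n\<le>d. ray_coeff h v n * of_real t ^ n)"
  have bound: "norm (?r t / of_real t ^ d) \<le> ?C * t" if t: "t > 0" for t :: real
  proof -
    define b where "b k = - (\<i> * complex_of_real (int_dot k v))" for k
    let ?z = "\<lambda>k. b k * of_real t"
    have dot: "int_dot k (t *\<^sub>R v) = int_dot k v * t" for k
      by (simp add: int_dot_def sum_distrib_left mult_ac)
    have "(\<Sum>n\<le>d. ray_coeff h v n * of_real t ^ n) = (\<Sum>k\<in>?K. ?c k * (\<Sum>n\<le>d. ?z k ^ n / fact n))"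
      unfolding ray_coeff_def sum_distrib_left sum_distrib_right b_def[symmetric]
      by (subst sum.swap) (simp add: power_mult_distrib mult_ac)
    then have "?r t = (\<Sum>k\<in>?K. ?c k * (exp (?z k) - (\<Sum>n\<le>d. ?z k ^ n / fact n)))"
      by (simp add: trig_eq character_def dot b_def right_diff_distrib sum_subtractf mult_ac)
    also have "norm \<dots> \<le> (\<Sum>k\<in>?K. cmod (?c k) * (\<bar>int_dot k v * t\<bar> ^ Suc d / fact d))"
    proof (rule sum_norm_le)
      fix k
      show "norm (?c k * (exp (?z k) - (\<Sum>n\<le>d. ?z k ^ n / fact n)))
        \<le> cmod (?c k) * (\<bar>int_dot k v * t\<bar> ^ Suc d / fact d)"
        using Taylor_exp[of "?z k" d]
        by (simp only: norm_mult) (intro mult_left_mono, simp_all add: b_def norm_mult abs_mult)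
    qed
    also have "\<dots> = (?C * t) * t ^ d"
      using t by (simp add: sum_distrib_left sum_distrib_right abs_mult power_mult_distrib mult_ac)
    finally show ?thesis using t by (simp add: norm_divide norm_power divide_le_eq)
  qed
  have "((\<lambda>t. ?C * t) \<longlongrightarrow> 0) (at_right 0)"
    by (auto intro!: tendsto_eq_intros)
  then show ?thesis
    by (rule Lim_null_comparison[rotated])
      (use bound in \<open>auto simp: eventually_at_right_field intro!: exI[of _ 1]\<close>)
qed

text \<open>Divide \<open>|\<phi>|\<^sup>2 \<le> \<Phi>\<close> by \<open>t\<^sup>2\<^sup>n\<close> and let \<open>t\<close> tend to \<open>0\<close>. If the coefficients before \<open>a n\<close> vanish,
  the left-hand side tends to \<open>|a n|\<^sup>2\<close>; the right-hand side tends to \<open>0\<close> for \<open>n < d\<close> and to \<open>\<beta>\<close> for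
  \<open>n = d\<close>. So the coefficients vanish one after the other up to \<open>d\<close>.\<close>

lemma leading_coefficient_bound:
  fixes \<phi> :: "real \<Rightarrow> complex" and a :: "nat \<Rightarrow> complex" and \<Phi> :: "real \<Rightarrow> real"
  assumes exp: "((\<lambda>t. (\<phi> t - (\<Sum>n\<le>d. a n * of_real t ^ n)) / of_real t ^ d) \<longlongrightarrow> 0) (at_right 0)"
    and \<Phi>: "((\<lambda>t. \<Phi> t / t ^ (2 * d)) \<longlongrightarrow> \<beta>) (at_right 0)"
    and le: "\<And>t. t > 0 \<Longrightarrow> (cmod (\<phi> t))\<^sup>2 \<le> \<Phi> t"
  shows "n < d \<Longrightarrow> a n = 0"
    and "(cmod (a d))\<^sup>2 \<le> \<beta>"
    and "((\<lambda>t. \<phi> t / of_real t ^ d) \<longlongrightarrow> a d) (at_right 0)"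
proof -
  have pos: "\<forall>\<^sub>F t::real in at_right 0. t > 0"
    by (simp add: eventually_at_right_less)
  have step: "((\<lambda>t. \<phi> t / of_real t ^ m) \<longlongrightarrow> a m) (at_right 0) \<and>
      (cmod (a m))\<^sup>2 \<le> (if m = d then \<beta> else 0)"
    if m: "m \<le> d" and zero: "\<And>i. i < m \<Longrightarrow> a i = 0" for m
  proof -
    have 1: "((\<lambda>t. (\<phi> t - (\<Sum>n\<le>d. a n * of_real t ^ n)) / of_real t ^ d * of_real t ^ (d - m)
        + (\<Sum>n\<in>{m..d}. a n * of_real t ^ (n - m)))
        \<longlongrightarrow> 0 * of_real 0 ^ (d - m) + (\<Sum>n\<in>{m..d}. a n * of_real 0 ^ (n - m))) (at_right 0)"
      by (intro tendsto_intros exp)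
    have "(\<Sum>n\<in>{m..d}. a n * of_real 0 ^ (n - m)) = (\<Sum>n\<in>{m}. a n)"
      by (rule sum.mono_neutral_cong_right) (use m in auto)
    then have 2: "0 * of_real 0 ^ (d - m) + (\<Sum>n\<in>{m..d}. a n * of_real 0 ^ (n - m)) = a m"
      by simp
    have eq: "(\<phi> t - (\<Sum>n\<le>d. a n * of_real t ^ n)) / of_real t ^ d * of_real t ^ (d - m)
        + (\<Sum>n\<in>{m..d}. a n * of_real t ^ (n - m)) = \<phi> t / of_real t ^ m" if t: "t > 0" for t
    proof -
      have "(\<Sum>n\<le>d. a n * of_real t ^ n) = (\<Sum>n\<in>{m..d}. a n * of_real t ^ n)"
        by (rule sum.mono_neutral_right) (use zero in \<open>auto simp: not_le\<close>)
      also have "\<dots> = (\<Sum>n\<in>{m..d}. a n * of_real t ^ (n - m)) * of_real t ^ m"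
        by (simp add: sum_distrib_right mult.assoc flip: power_add)
      finally have s: "(\<Sum>n\<le>d. a n * of_real t ^ n) = \<dots>" .
      have "complex_of_real t ^ d = of_real t ^ (d - m) * of_real t ^ m"
        using m by (simp flip: power_add)
      then show ?thesis using t by (simp add: s field_simps)
    qed
    have lim: "((\<lambda>t. \<phi> t / of_real t ^ m) \<longlongrightarrow> a m) (at_right 0)"
      by (rule Lim_transform_eventually[OF 1[unfolded 2]])
        (use pos in eventually_elim, simp only: eq)
    have "((\<lambda>t. \<Phi> t / t ^ (2 * d) * t ^ (2 * (d - m))) \<longlongrightarrow> \<beta> * 0 ^ (2 * (d - m))) (at_right 0)"
      by (intro tendsto_intros \<Phi>)
    moreover have "((\<lambda>t. (cmod (\<phi> t / of_real t ^ m))\<^sup>2) \<longlongrightarrow> (cmod (a m))\<^sup>2) (at_right 0)"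
      by (intro tendsto_intros lim)
    moreover have "\<forall>\<^sub>F t in at_right 0.
        (cmod (\<phi> t / of_real t ^ m))\<^sup>2 \<le> \<Phi> t / t ^ (2 * d) * t ^ (2 * (d - m))"
      using pos
    proof eventually_elim
      case (elim t)
      have "2 * d = 2 * (d - m) + 2 * m" using m by simp
      then have "t ^ (2 * d) = t ^ (2 * (d - m)) * t ^ (2 * m)"
        by (simp only: power_add)
      then have "\<Phi> t / t ^ (2 * d) * t ^ (2 * (d - m)) = \<Phi> t / (t ^ m)\<^sup>2"
        using elim by (simp add: power_mult[symmetric] mult.commute)
      then show ?case
        using le[OF elim] elim
        by (simp add: norm_divide norm_power power_divide divide_right_mono)
    qed
    ultimately have "(cmod (a m))\<^sup>2 \<le> \<beta> * 0 ^ (2 * (d - m))"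
      by (intro tendsto_le[of "at_right (0::real)"]) auto
    moreover have "(0::real) ^ (2 * (d - m)) = (if m = d then 1 else 0)"
      using m by auto
    ultimately show ?thesis using lim by (auto split: if_splits)
  qed
  have zero: "n < d \<Longrightarrow> a n = 0" for n
  proof (induction n rule: less_induct)
    case (less n)
    then show ?case using step[of n] by auto
  qed
  from zero show "n < d \<Longrightarrow> a n = 0" .
  from step[of d] zero
  show "(cmod (a d))\<^sup>2 \<le> \<beta>" "((\<lambda>t. \<phi> t / of_real t ^ d) \<longlongrightarrow> a d) (at_right 0)" by auto
qed

section \<open>A partition of unity that concentrates at a single point\<close>

text \<open>A polynomial with \<open>plateau n 0 = 0\<close> and \<open>plateau n 1 = 1\<close> that is flat to order \<open>n\<close> at \<open>1\<close> and to
  order \<open>2 * n\<close> at \<open>0\<close>. The greater flatness at \<open>0\<close> is what keeps sums below \<open>1\<close> in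
  \<open>sum_plateau_le_1\<close>.\<close>

definition plateau :: "nat \<Rightarrow> real \<Rightarrow> real" where
  "plateau n x = 1 - (1 - x ^ (2 * n)) ^ n"

lemma plateau_bounds:
  assumes "0 \<le> x" "x \<le> 1"
  shows "0 \<le> plateau n x" "plateau n x \<le> 1"
  using assms by (auto simp: plateau_def power_le_one)

text \<open>Let \<open>x m\<close> be the largest of the numbers and \<open>s\<close> the sum of the others. The others are at most
  \<open>min s (1 / 2)\<close>, and Bernoulli's inequality gives
  \<open>plateau n x \<le> n x\<^sup>2\<^sup>n = (n x\<^sup>n) (x x\<^sup>n\<^sup>-\<^sup>1) \<le> x s\<^sup>n\<^sup>-\<^sup>1\<close> for them, since \<open>n \<le> 2\<^sup>n\<close>. Hence they
  contribute at most \<open>s\<^sup>n \<le> (1 - x m)\<^sup>n\<close>, which is no more than the gap \<open>1 - plateau n (x m)\<close>.\<close>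

lemma sum_plateau_le_1:
  assumes fin: "finite I" and pos: "\<And>i. i \<in> I \<Longrightarrow> 0 \<le> x i" and le1: "(\<Sum>i\<in>I. x i) \<le> 1"
    and n: "n > 0"
  shows "(\<Sum>i\<in>I. plateau n (x i)) \<le> 1"
proof (cases "I = {}")
  case False
  have "Max (x ` I) \<in> x ` I" using fin False by simp
  then obtain m where m0: "m \<in> I" "x m = Max (x ` I)" by auto
  then have m: "m \<in> I" "\<And>i. i \<in> I \<Longrightarrow> x i \<le> x m"
    using fin by auto
  define s where "s = (\<Sum>i\<in>I - {m}. x i)"
  have Suc: "a ^ n = a * a ^ (n - 1)" for a :: real
    using n by (metis power_minus_mult mult.commute)
  have xs: "x m + s \<le> 1" "0 \<le> s"
    using le1 pos by (auto simp: s_def sum.remove[OF fin m(1)] intro!: sum_nonneg)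
  have xm: "0 \<le> x m" "x m \<le> 1 - s" using pos m xs by auto
  have "plateau n (x i) \<le> x i * s ^ (n - 1)" if i: "i \<in> I - {m}" for i
  proof -
    have xis: "x i \<le> s"
      unfolding s_def by (rule member_le_sum) (use i fin pos in auto)
    then have half: "x i \<le> 1 / 2" using xs m(2)[of i] i by auto
    have x0: "0 \<le> x i" using pos i by auto
    have "1 + real n * (- (x i ^ (2 * n))) \<le> (1 + (- (x i ^ (2 * n)))) ^ n"
      by (rule Bernoulli_inequality) (use x0 half in \<open>simp add: power_le_one\<close>)
    then have "plateau n (x i) \<le> real n * x i ^ (2 * n)"
      by (simp add: plateau_def)
    also have "\<dots> = (real n * x i ^ n) * (x i * x i ^ (n - 1))"
      unfolding Suc[symmetric] by (simp add: power_add mult_2)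
    also have "\<dots> \<le> 1 * (x i * s ^ (n - 1))"
    proof (rule mult_mono)
      have "real n * x i ^ n \<le> 2 ^ n * (1 / 2) ^ n"
        using x0 half by (intro mult_mono power_mono) (auto intro: less_imp_le of_nat_less_two_power)
      then show "real n * x i ^ n \<le> 1" by (simp add: power_divide)
      show "x i * x i ^ (n - 1) \<le> x i * s ^ (n - 1)"
        using x0 xis by (intro mult_left_mono power_mono)
    qed (use x0 in auto)
    finally show ?thesis by simp
  qed
  then have "(\<Sum>i\<in>I - {m}. plateau n (x i)) \<le> (\<Sum>i\<in>I - {m}. x i * s ^ (n - 1))"
    by (rule sum_mono)
  also have "\<dots> = s ^ n"
    by (subst Suc) (simp add: s_def flip: sum_distrib_right)
  also have "\<dots> \<le> (1 - x m ^ (2 * n)) ^ n"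
  proof (rule power_mono)
    have "x m ^ (2 * n) \<le> x m ^ 1"
      using xm xs n by (intro power_decreasing) auto
    then show "s \<le> 1 - x m ^ (2 * n)" using xm by simp
  qed (use xs in auto)
  finally show ?thesis
    by (simp add: sum.remove[OF fin m(1)] plateau_def)
qed auto

text \<open>Fejer's kernel, normalised to have the value \<open>1\<close> at \<open>0\<close>.\<close>

definition fejer :: "nat \<Rightarrow> real \<Rightarrow> real" where
  "fejer N s = (cmod ((\<Sum>k<N. cis (- (real k * s))) / of_nat N))\<^sup>2"

lemma fejer_0: "N > 0 \<Longrightarrow> fejer N 0 = 1"
  by (simp add: fejer_def)

lemma fejer_nonneg: "0 \<le> fejer N s"
  by (simp add: fejer_def)

lemma fejer_periodic: "fejer N (s + 2 * pi * of_int m) = fejer N s"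
proof -
  have "cis (- (real k * (s + 2 * pi * of_int m))) = cis (- (real k * s))" for k
  proof -
    have "- (real k * (s + 2 * pi * of_int m)) = - (real k * s) + 2 * pi * of_int (- int k * m)"
      by (simp add: algebra_simps)
    then show ?thesis by (simp only: cis_mult[symmetric] cis_multiple_2pi Ints_of_int) simp
  qed
  then show ?thesis by (simp add: fejer_def)
qed

lemma sum_character_cyclic:
  assumes "k < N" "l < N"
  shows "(\<Sum>m<N. cis (2 * pi * (real k - real l) * real m / real N)) = (if k = l then of_nat N else 0)"
proof (cases "k = l")
  case False
  define w where "w = cis (2 * pi * (real k - real l) / real N)"
  have N: "N > 0" using assms by simp
  have "w \<noteq> 1"
  proof
    assume "w = 1"
    then have "cos (2 * pi * (real k - real l) / real N) = 1"
      by (simp add: w_def complex_eq_iff)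
    then obtain i :: int where "2 * pi * (real k - real l) / real N = of_int i * 2 * pi"
      by (auto simp: cos_one_2pi_int)
    then have "2 * pi * (real k - real l) = 2 * pi * (of_int i * real N)"
      using N by (simp add: field_simps)
    then have "real k - real l = of_int i * real N" by (rule mult_left_cancel[THEN iffD1, rotated]) simp
    then have "real_of_int (int k - int l) = real_of_int (i * int N)" by simp
    then have eq: "int k - int l = i * int N" by (simp only: of_int_eq_iff)
    then have "\<bar>i\<bar> * int N < 1 * int N"
      using assms by (simp add: abs_mult[symmetric, of i "int N", simplified] flip: eq)
    then have "i = 0" using N by (simp only: mult_less_cancel_right) auto
    with eq False show False by simp
  qed
  moreover have "w ^ N = 1"
  proof -
    have "w ^ N = cis (real N * (2 * pi * (real k - real l) / real N))"
      by (simp only: w_def Complex.DeMoivre)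
    also have "real N * (2 * pi * (real k - real l) / real N) = 2 * pi * of_int (int k - int l)"
      using N by simp
    finally show ?thesis by (simp only: cis_multiple_2pi Ints_of_int)
  qed
  moreover have "cis (2 * pi * (real k - real l) * real m / real N) = w ^ m" for m
    by (simp add: w_def Complex.DeMoivre field_simps)
  ultimately show ?thesis using False by (simp add: geometric_sum)
qed auto

text \<open>Expand the square of the modulus into a double sum of characters: summing over the grid
  annihilates the terms off the diagonal, and the \<open>N\<close> diagonal terms contribute \<open>N / N\<^sup>2\<close> each.\<close>

lemma sum_fejer_grid:
  assumes N: "N > 0"
  shows "(\<Sum>m<N. fejer N (s + 2 * pi * real m / real N)) = 1"
proof -
  let ?a = "\<lambda>m k. cis (- (real k * (s + 2 * pi * real m / real N)))"
  have 1: "complex_of_real (fejer N (s + 2 * pi * real m / real N)) =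
      (\<Sum>k<N. \<Sum>l<N. cis ((real k - real l) * - s) * cis (2 * pi * (real l - real k) * real m / real N))
        / (of_nat N)\<^sup>2" for m
  proof -
    have "complex_of_real (fejer N (s + 2 * pi * real m / real N)) =
       (\<Sum>k<N. ?a m k) * cnj (\<Sum>l<N. ?a m l) / (of_nat N)\<^sup>2"
      unfolding fejer_def complex_norm_square by (simp add: power2_eq_square)
    also have "(\<Sum>k<N. ?a m k) * cnj (\<Sum>l<N. ?a m l) = (\<Sum>k<N. \<Sum>l<N.
        cis ((real k - real l) * - s) * cis (2 * pi * (real l - real k) * real m / real N))"
      unfolding cnj_sum sum_product cis_cnj cis_mult
      by (intro sum.cong refl arg_cong[of _ _ cis]) (use N in \<open>simp add: field_simps\<close>)
    finally show ?thesis .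
  qed
  have "complex_of_real (\<Sum>m<N. fejer N (s + 2 * pi * real m / real N)) =
     (\<Sum>m<N. \<Sum>k<N. \<Sum>l<N. cis ((real k - real l) * - s) * cis (2 * pi * (real l - real k) * real m / real N))
        / (of_nat N)\<^sup>2"
    unfolding of_real_sum 1 sum_divide_distrib ..
  also have "(\<Sum>m<N. \<Sum>k<N. \<Sum>l<N. cis ((real k - real l) * - s) * cis (2 * pi * (real l - real k) * real m / real N))
     = (\<Sum>k<N. \<Sum>l<N. cis ((real k - real l) * - s) *
         (\<Sum>m<N. cis (2 * pi * (real l - real k) * real m / real N)))"
    unfolding sum_distrib_left by (subst sum.swap) (intro sum.cong refl sum.swap)
  also have "\<dots> = (\<Sum>k<N. \<Sum>l<N. if l = k then of_nat N else 0)"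
    by (intro sum.cong refl) (simp add: sum_character_cyclic)
  also have "\<dots> = (of_nat N)\<^sup>2"
    by (simp add: power2_eq_square)
  finally have "complex_of_real (\<Sum>m<N. fejer N (s + 2 * pi * real m / real N)) = of_real 1"
    using N by simp
  then show ?thesis by (simp only: of_real_eq_iff)
qed

definition bump :: "nat \<Rightarrow> real ^ 3 \<Rightarrow> real" where
  "bump N \<omega> = (\<Prod>j\<in>UNIV. fejer N (\<omega> $ j))"

lemma bump_0: "N > 0 \<Longrightarrow> bump N 0 = 1"
  by (simp add: bump_def fejer_0)

lemma bump_nonneg: "0 \<le> bump N \<omega>"
  by (simp add: bump_def fejer_nonneg prod_nonneg)

lemma is_trig_bump: "is_trig (\<lambda>\<omega>. of_real (bump N \<omega>))"
proof -
  have "complex_of_real (bump N \<omega>) = (\<Prod>j\<in>UNIV. ((\<Sum>k<N. character (axis j (int k)) \<omega>) * (1 / of_nat N)) *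
      cnj ((\<Sum>k<N. character (axis j (int k)) \<omega>) * (1 / of_nat N)))" for \<omega>
    unfolding bump_def fejer_def of_real_prod complex_norm_square
    by (simp add: character_axis cis_conv_exp)
  then show ?thesis by (simp only:) (intro is_trig_intros)
qed

text \<open>By Cramer's rule, \<open>det M\<close> is a common denominator of the entries of the inverse of \<open>M\<close>.\<close>

lemma fine_lattice_denominator:
  assumes M: "det M \<noteq> 0" and x: "x \<in> fine_lattice M"
  shows "\<exists>n :: int ^ 3. \<forall>j. x $ j = 2 * pi * of_int (n $ j) / real (nat \<bar>det M\<bar>)"
proof -
  define A :: "real ^ 3 ^ 3" where "A = transpose (map_matrix of_int M)"
  have detA: "det A = of_int (det M)"
    unfolding A_def det_transpose unfolding det_3 by simp
  then have A: "invertible A" "det A \<noteq> 0" using M by (auto simp: invertible_det_nz)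
  obtain k :: "int ^ 3" where k: "x = matrix_inv A *v (\<chi> j. 2 * pi * of_int (k $ j))"
    using x by (auto simp: fine_lattice_def two_pi_lattice_def A_def)
  have "A ** matrix_inv A = mat 1" using A(1)
    unfolding invertible_def matrix_inv_def by (rule someI2_ex) blast
  then have "A *v x = (\<chi> j. 2 * pi * of_int (k $ j))"
    by (simp add: k matrix_vector_mul_assoc)
  then have cramer: "x = (\<chi> l. det (\<chi> i j. if j = l then (\<chi> j. 2 * pi * of_int (k $ j)) $ i
      else A $ i $ j) / det A)"
    by (rule iffD1[OF cramer[OF A(2)]])
  define n :: "int ^ 3" where
    "n = (\<chi> l. sgn (det M) * det (\<chi> i j. if j = l then k $ i else transpose M $ i $ j))"
  have "det (\<chi> i j. if j = l then (\<chi> j. 2 * pi * of_int (k $ j)) $ i else A $ i $ j)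
      = 2 * pi * of_int (sgn (det M) * n $ l)" for l
    using exhaust_3[of l] M unfolding n_def det_3
    by (auto simp: A_def transpose_def algebra_simps sgn_if)
  then have "x $ l = 2 * pi * of_int (sgn (det M) * n $ l) / of_int (det M)" for l
    by (subst cramer) (simp add: detA)
  moreover obtain N where N: "N = real (nat \<bar>det M\<bar>)" by simp
  moreover have "sgn (det M) = 1 \<and> of_int (det M) = N \<or> sgn (det M) = - 1 \<and> of_int (det M) = - N"
    using M by (auto simp: sgn_if N)
  ultimately have "x $ l = 2 * pi * of_int (n $ l) / N" for l
    by auto
  then show ?thesis unfolding N by blast
qed

text \<open>Reducing numerators modulo \<open>N\<close> embeds \<open>dual_group M\<close> into the grid \<open>{0, ..., N - 1}\<^sup>3\<close>. All
  terms are nonnegative, so the sum is at most the one over the full grid, which factors into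
  three sums over one-dimensional grids.\<close>

lemma sum_bump_dual_group_le_1:
  assumes M: "det M \<noteq> 0" and s: "\<And>\<sigma>. \<sigma> \<in> dual_group M \<Longrightarrow> s \<sigma> \<in> \<sigma>"
  defines "N \<equiv> nat \<bar>det M\<bar>"
  shows "(\<Sum>\<sigma>\<in>dual_group M. bump N (\<omega> + s \<sigma>)) \<le> 1"
proof -
  have N: "N > 0" using M by (simp add: N_def)
  have fine: "s \<sigma> \<in> fine_lattice M" if "\<sigma> \<in> dual_group M" for \<sigma>
    using s[OF that] that in_quotient_imp_subset[OF equiv_lattice_rel] by (auto simp: dual_group_def)
  have "\<forall>\<sigma>\<in>dual_group M. \<exists>n :: int ^ 3. \<forall>j. s \<sigma> $ j = 2 * pi * of_int (n $ j) / real N"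
    unfolding N_def using fine_lattice_denominator[OF M fine] by blast
  then obtain n :: "_ \<Rightarrow> int ^ 3" where
    "\<forall>\<sigma>\<in>dual_group M. \<forall>j. s \<sigma> $ j = 2 * pi * of_int (n \<sigma> $ j) / real N"
    by (rule bchoice[THEN exE])
  then have n: "\<And>\<sigma> j. \<sigma> \<in> dual_group M \<Longrightarrow> s \<sigma> $ j = 2 * pi * of_int (n \<sigma> $ j) / real N"
    by blast
  define g where "g \<sigma> j = nat (n \<sigma> $ j mod int N)" for \<sigma> j
  have g: "s \<sigma> $ j = 2 * pi * real (g \<sigma> j) / real N + 2 * pi * of_int (n \<sigma> $ j div int N)"
    if "\<sigma> \<in> dual_group M" for \<sigma> j
  proof -
    have "real_of_int (n \<sigma> $ j) = of_int (n \<sigma> $ j div int N) * real N + real (g \<sigma> j)"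
    proof -
      have "n \<sigma> $ j = n \<sigma> $ j div int N * int N + int (g \<sigma> j)"
        using N by (simp add: g_def)
      then show ?thesis by (metis of_int_add of_int_mult of_int_of_nat_eq)
    qed
    then show ?thesis using N by (simp add: n[OF that] field_simps)
  qed
  \<comment> \<open>Equal residues mean that the representatives differ by an element of \<open>2 \<pi> \<int>\<^sup>3\<close>.\<close>
  have inj: "inj_on g (dual_group M)"
  proof (rule inj_onI)
    fix \<sigma> \<tau> assume st: "\<sigma> \<in> dual_group M" "\<tau> \<in> dual_group M" "g \<sigma> = g \<tau>"
    have "s \<sigma> - s \<tau> =
        (\<chi> j. 2 * pi * of_int ((\<chi> j. n \<sigma> $ j div int N - n \<tau> $ j div int N) $ j))"
      by (simp add: vec_eq_iff g[OF st(1)] g[OF st(2)] st(3) algebra_simps)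
    then have "s \<sigma> - s \<tau> \<in> two_pi_lattice"
      unfolding two_pi_lattice_def by (rule range_eqI)
    then have "(s \<sigma>, s \<tau>) \<in> lattice_rel M"
      using fine st by (simp add: lattice_rel_def)
    then show "\<sigma> = \<tau>"
      using quotient_eq_iff[OF equiv_lattice_rel, of \<sigma> M \<tau> "s \<sigma>" "s \<tau>"] st s
      by (simp add: dual_group_def)
  qed
  let ?G = "UNIV \<rightarrow>\<^sub>E {..<N} :: (3 \<Rightarrow> nat) set"
  have img: "g ` dual_group M \<subseteq> ?G"
    using N by (auto simp: g_def nat_less_iff)
  let ?F = "\<lambda>m. \<Prod>j\<in>UNIV. fejer N (\<omega> $ j + 2 * pi * real (m j) / real N)"
  have "(\<Sum>\<sigma>\<in>dual_group M. bump N (\<omega> + s \<sigma>)) = (\<Sum>\<sigma>\<in>dual_group M. ?F (g \<sigma>))"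
    unfolding bump_def
    by (intro sum.cong refl prod.cong) (simp add: g fejer_periodic add.assoc[symmetric])
  also have "\<dots> = (\<Sum>m\<in>g ` dual_group M. ?F m)"
    using inj by (simp add: sum.reindex)
  also have "\<dots> \<le> (\<Sum>m\<in>?G. ?F m)"
    by (rule sum_mono2[OF _ img]) (auto intro!: finite_PiE prod_nonneg fejer_nonneg)
  also have "\<dots> = (\<Prod>j\<in>UNIV. \<Sum>m<N. fejer N (\<omega> $ j + 2 * pi * real m / real N))"
    by (subst prod_sum_PiE) auto
  also have "\<dots> = 1" using sum_fejer_grid[OF N] by simp
  finally show ?thesis .
qed

section \<open>The Motzkin form\<close>

definition motzkin :: "real \<Rightarrow> real \<Rightarrow> real \<Rightarrow> real" where
  "motzkin x y z = x ^ 4 * y\<^sup>2 + x\<^sup>2 * y ^ 4 + z ^ 6 - 3 * x\<^sup>2 * y\<^sup>2 * z\<^sup>2"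

text \<open>With \<open>g = |x y|\<close> we have \<open>x\<^sup>2 + y\<^sup>2 \<ge> 2 g\<close>, and
  \<open>2 g\<^sup>3 + z\<^sup>6 - 3 g\<^sup>2 z\<^sup>2 = (z\<^sup>2 - g)\<^sup>2 (z\<^sup>2 + 2 g)\<close>.\<close>

lemma motzkin_nonneg: "0 \<le> motzkin x y z"
proof -
  define g where "g = \<bar>x * y\<bar>"
  have g: "g \<ge> 0" "x\<^sup>2 * y\<^sup>2 = g\<^sup>2" by (auto simp: g_def power_mult_distrib)
  have "2 * g \<le> x\<^sup>2 + y\<^sup>2"
    using sum_squares_bound[of "\<bar>x\<bar>" "\<bar>y\<bar>"] by (simp add: g_def abs_mult)
  then have "g\<^sup>2 * (2 * g) \<le> g\<^sup>2 * (x\<^sup>2 + y\<^sup>2)" by (rule mult_left_mono) simp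
  moreover have "0 \<le> (z\<^sup>2 - g)\<^sup>2 * (z\<^sup>2 + 2 * g)" using g by simp
  moreover have "motzkin x y z = g\<^sup>2 * (x\<^sup>2 + y\<^sup>2) + z ^ 6 - 3 * g\<^sup>2 * z\<^sup>2"
    unfolding motzkin_def g(2)[symmetric] by algebra
  moreover have "(z\<^sup>2 - g)\<^sup>2 * (z\<^sup>2 + 2 * g) = g\<^sup>2 * (2 * g) + z ^ 6 - 3 * g\<^sup>2 * z\<^sup>2"
    by algebra
  ultimately show ?thesis by linarith
qed

lemma motzkin_le_3:
  assumes "\<bar>x\<bar> \<le> 1" "\<bar>y\<bar> \<le> 1" "\<bar>z\<bar> \<le> 1"
  shows "motzkin x y z \<le> 3"
proof -
  have sq: "x\<^sup>2 \<le> 1" "y\<^sup>2 \<le> 1" "z\<^sup>2 \<le> 1" using assms by (auto simp: abs_square_le_1)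
  have "(x\<^sup>2)\<^sup>2 * y\<^sup>2 \<le> 1"
    by (intro mult_le_one power_le_one zero_le_power2 sq)
  moreover have "x\<^sup>2 * (y\<^sup>2)\<^sup>2 \<le> 1"
    by (intro mult_le_one power_le_one zero_le_power2 sq)
  moreover have "(z\<^sup>2) ^ 3 \<le> 1"
    by (intro power_le_one zero_le_power2 sq)
  moreover have "0 \<le> 3 * x\<^sup>2 * y\<^sup>2 * z\<^sup>2" by simp
  moreover have "motzkin x y z
      = (x\<^sup>2)\<^sup>2 * y\<^sup>2 + x\<^sup>2 * (y\<^sup>2)\<^sup>2 + (z\<^sup>2) ^ 3 - 3 * x\<^sup>2 * y\<^sup>2 * z\<^sup>2"
    by (simp add: motzkin_def flip: power_mult)
  ultimately show ?thesis by linarith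
qed

lemma motzkin_homogeneous: "motzkin (t * x) (t * y) (t * z) = t ^ 6 * motzkin x y z"
  unfolding motzkin_def by algebra

text \<open>On the lines \<open>(1, 0, t)\<close> and \<open>(0, 1, t)\<close> the Motzkin form is \<open>t\<^sup>6\<close>, hence \<open>L = O (t\<^sup>3)\<close> there and
  the coefficients of \<open>x\<^sup>2 z\<close> and \<open>y\<^sup>2 z\<close> in \<open>L\<close> vanish. The Motzkin form also vanishes at the
  four points \<open>(\<plusminus>1, \<plusminus>1, 1)\<close>. Summing \<open>L\<close> over these points leaves only the monomials that are even
  in \<open>x\<close> and in \<open>y\<close>, namely \<open>z\<^sup>3\<close>, \<open>x\<^sup>2 z\<close> and \<open>y\<^sup>2 z\<close>.

  Writing \<open>L\<close> as a sum of cubes of linear forms is the shape in which it arises as \<open>ray_coeff\<close>.\<close>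

lemma cubic_below_motzkin:
  fixes c u v w :: "'a \<Rightarrow> complex" and K :: "'a set"
  defines "L \<equiv> \<lambda>x y z :: real. \<Sum>k\<in>K. c k * (of_real x * u k + of_real y * v k + of_real z * w k) ^ 3"
  assumes le: "\<And>x y z. (cmod (L x y z))\<^sup>2 \<le> C * motzkin x y z"
  shows "L 0 0 1 = 0"
proof -
  have mixed: "(\<Sum>k\<in>K. c k * ((u' k)\<^sup>2 * w k)) = 0"
    if le: "\<And>t :: real. (cmod (\<Sum>k\<in>K. c k * (u' k + of_real t * w k) ^ 3))\<^sup>2 \<le> C * t ^ 6" for u'
  proof -
    define a where "a n = (\<Sum>k\<in>K. c k * (of_nat (3 choose n) * u' k ^ (3 - n) * w k ^ n))" for n
    have "(\<Sum>n\<le>3. a n * of_real t ^ n) = (\<Sum>k\<in>K. c k * (u' k + of_real t * w k) ^ 3)" for t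
      unfolding a_def sum_distrib_right
      by (subst sum.swap) (simp add: add.commute[of "u' _"] binomial_ring sum_distrib_left
          power_mult_distrib mult_ac)
    moreover have "((\<lambda>t::real. C * t ^ 6 / t ^ (2 * 3)) \<longlongrightarrow> C) (at_right 0)"
      by (rule tendsto_eventually) (auto simp: eventually_at_right_field intro: exI[of _ 1])
    ultimately have "a 1 = 0"
      by (intro leading_coefficient_bound(1)[where d = 3 and \<Phi> = "\<lambda>t. C * t ^ 6" and \<beta> = C and a = a
            and \<phi> = "\<lambda>t. \<Sum>k\<in>K. c k * (u' k + of_real t * w k) ^ 3"])
        (use le in auto)
    then have "3 * (\<Sum>k\<in>K. c k * ((u' k)\<^sup>2 * w k)) = 0"
      by (simp add: a_def sum_distrib_left mult_ac)
    then show ?thesis by simp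
  qed
  have xz: "(\<Sum>k\<in>K. c k * ((u k)\<^sup>2 * w k)) = 0"
    by (rule mixed) (use le[of 1 0] in \<open>simp add: L_def motzkin_def\<close>)
  have yz: "(\<Sum>k\<in>K. c k * ((v k)\<^sup>2 * w k)) = 0"
    by (rule mixed) (use le[of 0 1] in \<open>simp add: L_def motzkin_def\<close>)
  have zero: "L 1 1 1 = 0" "L (-1) 1 1 = 0" "L 1 (-1) 1 = 0" "L (-1) (-1) 1 = 0"
    using le[of 1 1 1] le[of "-1" 1 1] le[of 1 "-1" 1] le[of "-1" "-1" 1]
    by (simp_all add: motzkin_def)
  have "L 1 1 1 + L (-1) 1 1 + L 1 (-1) 1 + L (-1) (-1) 1 =
      4 * L 0 0 1 + 12 * (\<Sum>k\<in>K. c k * ((u k)\<^sup>2 * w k)) + 12 * (\<Sum>k\<in>K. c k * ((v k)\<^sup>2 * w k))"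
    unfolding L_def sum_distrib_left sum.distrib[symmetric]
    by (intro sum.cong refl) (simp, algebra)
  then show ?thesis using zero xz yz by simp
qed

section \<open>The Motzkin mask\<close>

text \<open>The division by \<open>3\<close> keeps the second factor in \<open>[0, 1]\<close>, by \<open>motzkin_le_3\<close>. Any exponent
  \<open>n \<ge> 7\<close> would do for \<open>plateau\<close>: its deviation from \<open>1\<close> has to vanish at \<open>0\<close> to an order above
  \<open>6\<close>, the degree of the Motzkin form.\<close>

definition motzkin_mask :: "nat \<Rightarrow> real ^ 3 \<Rightarrow> real" where
  "motzkin_mask N \<omega> = plateau 7 (bump N \<omega>) * (1 - motzkin (sin (\<omega> $ 1)) (sin (\<omega> $ 2)) (sin (\<omega> $ 3)) / 3)"

lemma is_trig_motzkin_mask: "is_trig (\<lambda>\<omega>. of_real (motzkin_mask N \<omega>))"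
proof -
  have "is_trig (\<lambda>\<omega>. complex_of_real (plateau 7 (bump N \<omega>)))"
    unfolding plateau_def of_real_diff of_real_power of_real_1
    by (intro is_trig_intros is_trig_bump)
  moreover have "is_trig (\<lambda>\<omega>. complex_of_real
      (1 - motzkin (sin (\<omega> $ 1)) (sin (\<omega> $ 2)) (sin (\<omega> $ 3)) * (1 / 3)))"
    unfolding motzkin_def of_real_diff of_real_add of_real_mult of_real_power of_real_1 of_real_numeral
    by (intro is_trig_intros)
  ultimately show ?thesis
    unfolding motzkin_mask_def by (auto dest: is_trig_mult)
qed

lemma motzkin_mask_0: "N > 0 \<Longrightarrow> motzkin_mask N 0 = 1"
  by (simp add: motzkin_mask_def bump_0 plateau_def motzkin_def)

lemma motzkin_mask_bounds:
  assumes "bump N \<omega> \<le> 1"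
  shows "0 \<le> motzkin_mask N \<omega>" "motzkin_mask N \<omega> \<le> plateau 7 (bump N \<omega>)" "motzkin_mask N \<omega> \<le> 1"
proof -
  have q: "0 \<le> motzkin (sin (\<omega> $ 1)) (sin (\<omega> $ 2)) (sin (\<omega> $ 3))"
    "motzkin (sin (\<omega> $ 1)) (sin (\<omega> $ 2)) (sin (\<omega> $ 3)) \<le> 3"
    by (auto intro: motzkin_nonneg motzkin_le_3)
  note H = plateau_bounds[OF bump_nonneg assms, of 7]
  show "0 \<le> motzkin_mask N \<omega>" using q H by (simp add: motzkin_mask_def)
  show le: "motzkin_mask N \<omega> \<le> plateau 7 (bump N \<omega>)"
    unfolding motzkin_mask_def using q H by (intro mult_left_le) auto
  show "motzkin_mask N \<omega> \<le> 1" using le H by linarith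
qed

text \<open>Numbers in \<open>[0, 1]\<close> are at least their squares, so the shifts of the plateau, which dominate
  those of the mask, may be summed instead.\<close>

lemma motzkin_mask_sub_QMF:
  assumes M: "expansive M" and s: "\<And>\<sigma>. \<sigma> \<in> dual_group M \<Longrightarrow> s \<sigma> \<in> \<sigma>"
  defines "N \<equiv> nat \<bar>det M\<bar>"
  shows "(\<Sum>\<sigma>\<in>dual_group M. (motzkin_mask N (\<omega> + s \<sigma>))\<^sup>2) \<le> 1"
proof -
  have sum: "(\<Sum>\<sigma>\<in>dual_group M. bump N (\<omega> + s \<sigma>)) \<le> 1"
    unfolding N_def using expansive_det[OF M] s by (rule sum_bump_dual_group_le_1)
  have "(\<Sum>\<sigma>\<in>dual_group M. (motzkin_mask N (\<omega> + s \<sigma>))\<^sup>2)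
      \<le> (\<Sum>\<sigma>\<in>dual_group M. plateau 7 (bump N (\<omega> + s \<sigma>)))"
  proof (rule sum_mono)
    fix \<sigma> assume "\<sigma> \<in> dual_group M"
    then have "bump N (\<omega> + s \<sigma>) \<le> (\<Sum>\<sigma>\<in>dual_group M. bump N (\<omega> + s \<sigma>))"
      by (intro member_le_sum bump_nonneg finite_dual_group M) auto
    then have "bump N (\<omega> + s \<sigma>) \<le> 1" using sum by linarith
    note b = motzkin_mask_bounds[OF this]
    have "(motzkin_mask N (\<omega> + s \<sigma>))\<^sup>2 \<le> motzkin_mask N (\<omega> + s \<sigma>)"
      unfolding power2_eq_square using b by (intro mult_left_le) auto
    with b show "(motzkin_mask N (\<omega> + s \<sigma>))\<^sup>2 \<le> plateau 7 (bump N (\<omega> + s \<sigma>))" by linarith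
  qed
  also have "\<dots> \<le> 1"
    by (rule sum_plateau_le_1) (use sum finite_dual_group[OF M] bump_nonneg in auto)
  finally show ?thesis .
qed

text \<open>Both \<open>1 - plateau\<close> and the Motzkin term are small at \<open>0\<close>, so \<open>1 - p\<^sup>2\<close> behaves like twice their
  sum; the former is \<open>O (t\<^sup>7)\<close>.\<close>

lemma motzkin_mask_ray_limit:
  assumes N: "N > 0"
  shows "((\<lambda>t. (1 - (motzkin_mask N (t *\<^sub>R v))\<^sup>2) / t ^ 6) \<longlongrightarrow> 2 / 3 * motzkin (v $ 1) (v $ 2) (v $ 3))
    (at_right 0)"
proof -
  let ?m = "motzkin (v $ 1) (v $ 2) (v $ 3)"
  have pos: "\<forall>\<^sub>F t::real in at_right 0. t > 0"
    by (simp add: eventually_at_right_less)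
  have t0: "((\<lambda>t::real. t) \<longlongrightarrow> 0) (at_right 0)" by (rule tendsto_ident_at)
  define u where "u t = 1 - bump N (t *\<^sub>R v) ^ 14" for t
  define q where "q t = motzkin (sin (t * v $ 1)) (sin (t * v $ 2)) (sin (t * v $ 3)) / 3" for t
  \<comment> \<open>The mask along the ray is \<open>(1 - u\<^sup>7) (1 - q) = 1 - w\<close>.\<close>
  define w where "w t = u t ^ 7 + q t - u t ^ 7 * q t" for t
  \<comment> \<open>The expansion of trigonometric polynomials gives \<open>u = O (t)\<close>, which suffices since \<open>u\<close> enters with
    the power \<open>7\<close>.\<close>
  have "is_trig (\<lambda>\<omega>. complex_of_real (1 - bump N \<omega> ^ 14))"
    unfolding of_real_diff of_real_power of_real_1 by (intro is_trig_intros is_trig_bump)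
  then obtain h where h: "\<And>\<omega>. trig h \<omega> = of_real (1 - bump N \<omega> ^ 14)"
    unfolding is_trig_def by blast
  have "ray_coeff h v 0 = trig h 0"
    by (simp add: ray_coeff_def trig_eq character_def int_dot_def)
  then have r0: "ray_coeff h v 0 = 0" by (simp add: h bump_0[OF N])
  have exp: "((\<lambda>t. (trig h (t *\<^sub>R v) - (\<Sum>n\<le>1. ray_coeff h v n * of_real t ^ n)) / of_real t ^ 1
      + ray_coeff h v 1) \<longlongrightarrow> 0 + ray_coeff h v 1) (at_right 0)"
    by (intro tendsto_intros trig_ray_expansion)
  have "((\<lambda>t. complex_of_real (u t / t)) \<longlongrightarrow> ray_coeff h v 1) (at_right 0)"
    by (rule Lim_transform_eventually[OF exp, unfolded add_0_left])
      (use pos in eventually_elim, simp add: h u_def r0 diff_divide_distrib)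
  from tendsto_Re[OF this]
  have u1: "((\<lambda>t. u t / t) \<longlongrightarrow> Re (ray_coeff h v 1)) (at_right 0)"
    by simp
  have pow: "((\<lambda>t. (u t / t) ^ 7 * t) \<longlongrightarrow> (Re (ray_coeff h v 1)) ^ 7 * 0) (at_right 0)"
    by (intro tendsto_intros u1 t0)
  have u7: "((\<lambda>t. u t ^ 7 / t ^ 6) \<longlongrightarrow> 0) (at_right 0)"
  proof (rule Lim_transform_eventually[OF pow, unfolded mult_zero_right])
    have seven: "a ^ 7 = a ^ 6 * a" for a :: real
      by (simp flip: power_Suc2)
    show "\<forall>\<^sub>F t in at_right 0. (u t / t) ^ 7 * t = u t ^ 7 / t ^ 6"
      using pos by eventually_elim (simp add: seven power_divide)
  qed
  have sin: "((\<lambda>t. sin (t * a) / t) \<longlongrightarrow> a) (at_right 0)" for a :: real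
  proof -
    have "((\<lambda>t. sin (t * a)) has_real_derivative a) (at 0)"
      by (auto intro!: derivative_eq_intros)
    then have "((\<lambda>t. sin (t * a) / t) \<longlongrightarrow> a) (at 0)"
      by (simp add: DERIV_def)
    then show ?thesis by (rule tendsto_within_subset) simp
  qed
  have "((\<lambda>t. motzkin (sin (t * v $ 1) / t) (sin (t * v $ 2) / t) (sin (t * v $ 3) / t) / 3)
      \<longlongrightarrow> ?m / 3) (at_right 0)"
    unfolding motzkin_def by (intro tendsto_intros sin) auto
  then have q6: "((\<lambda>t. q t / t ^ 6) \<longlongrightarrow> ?m / 3) (at_right 0)"
  proof (rule Lim_transform_eventually)
    show "\<forall>\<^sub>F t in at_right 0. motzkin (sin (t * v $ 1) / t) (sin (t * v $ 2) / t) (sin (t * v $ 3) / t) / 3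
        = q t / t ^ 6"
      using pos
    proof eventually_elim
      case (elim t)
      then show ?case
        using motzkin_homogeneous[of t "sin (t * v $ 1) / t" "sin (t * v $ 2) / t" "sin (t * v $ 3) / t"]
        by (simp add: q_def field_simps)
    qed
  qed
  have to0: "(f \<longlongrightarrow> 0) (at_right 0)" if "((\<lambda>t. f t / t ^ 6) \<longlongrightarrow> l) (at_right 0)"
    for f :: "real \<Rightarrow> real" and l
  proof -
    have "((\<lambda>t. f t / t ^ 6 * t ^ 6) \<longlongrightarrow> l * 0 ^ 6) (at_right 0)"
      by (intro tendsto_intros that t0)
    then have "((\<lambda>t. f t / t ^ 6 * t ^ 6) \<longlongrightarrow> 0) (at_right 0)" by simp
    then show ?thesis
      by (rule Lim_transform_eventually) (use pos in eventually_elim, simp)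
  qed
  have "((\<lambda>t. u t ^ 7 / t ^ 6 + q t / t ^ 6 - u t ^ 7 * (q t / t ^ 6)) \<longlongrightarrow> 0 + ?m / 3 - 0 * (?m / 3))
      (at_right 0)"
    by (intro tendsto_intros u7 q6 to0[OF u7])
  then have w6: "((\<lambda>t. w t / t ^ 6) \<longlongrightarrow> ?m / 3) (at_right 0)"
    by (simp add: w_def add_divide_distrib diff_divide_distrib)
  have lim: "((\<lambda>t. w t / t ^ 6 * (2 - w t)) \<longlongrightarrow> ?m / 3 * (2 - 0)) (at_right 0)"
    by (intro tendsto_intros w6 to0[OF w6])
  have ratio: "w t / t ^ 6 * (2 - w t) = (1 - (motzkin_mask N (t *\<^sub>R v))\<^sup>2) / t ^ 6" for t
  proof -
    have "motzkin_mask N (t *\<^sub>R v) = (1 - u t ^ 7) * (1 - q t)"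
      by (simp add: motzkin_mask_def plateau_def u_def q_def)
    then have eq: "motzkin_mask N (t *\<^sub>R v) = 1 - w t"
      by (simp add: w_def algebra_simps)
    show ?thesis unfolding eq by (simp add: power2_eq_square algebra_simps)
  qed
  show ?thesis using lim unfolding ratio by (simp add: mult.commute)
qed

section \<open>Hermitian squares\<close>

text \<open>The cubic leading form of \<open>h\<close> satisfies the hypothesis of \<open>cubic_below_motzkin\<close>. The factor
  \<open>i / 6\<close> is \<open>(- i)\<^sup>3 / 3!\<close>.\<close>

lemma hermitian_square_below_motzkin:
  assumes \<Phi>: "\<And>v. ((\<lambda>t. \<Phi> (t *\<^sub>R v) / t ^ 6) \<longlongrightarrow> C * motzkin (v $ 1) (v $ 2) (v $ 3)) (at_right 0)"
    and le: "\<And>\<omega>. (cmod (trig h \<omega>))\<^sup>2 \<le> \<Phi> \<omega>"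
  shows "((\<lambda>t. trig h (t *\<^sub>R axis 3 1) / of_real t ^ 3) \<longlongrightarrow> 0) (at_right 0)"
proof -
  let ?K = "Poly_Mapping.keys h"
  define L where "L x y z = (\<Sum>k\<in>?K. Poly_Mapping.lookup h k * (\<i> / 6) *
      (of_real x * of_int (k $ 1) + of_real y * of_int (k $ 2) + of_real z * of_int (k $ 3)) ^ 3)"
    for x y z :: real
  have coeff: "ray_coeff h v 3 = L (v $ 1) (v $ 2) (v $ 3)" for v
    unfolding ray_coeff_def L_def
    by (intro sum.cong refl)
      (simp add: int_dot_def sum_3 fact_numeral power_mult_distrib power3_eq_cube mult_ac)
  have \<Phi>': "((\<lambda>t. \<Phi> (t *\<^sub>R v) / t ^ (2 * 3)) \<longlongrightarrow> C * motzkin (v $ 1) (v $ 2) (v $ 3)) (at_right 0)" for v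
    using \<Phi>[of v] by simp
  note bound = leading_coefficient_bound[OF trig_ray_expansion \<Phi>' le]
  have "(cmod (L x y z))\<^sup>2 \<le> C * motzkin x y z" for x y z
    using bound(2)[of "vector [x, y, z]"] by (simp add: coeff)
  then have "L 0 0 1 = 0"
    unfolding L_def by (rule cubic_below_motzkin)
  then have "ray_coeff h (axis 3 1) 3 = 0"
    by (simp add: coeff axis_def)
  then show ?thesis
    using bound(3)[of "axis 3 1"] by simp
qed

text \<open>Each square is at most \<open>\<Phi>\<close>, so each is of smaller order than \<open>t\<^sup>6\<close> along the third axis, where
  \<open>\<Phi>\<close> has the exact order \<open>t\<^sup>6\<close>.\<close>

lemma not_sum_hermitian_squares_if_motzkin:
  assumes \<Phi>: "\<And>v. ((\<lambda>t. \<Phi> (t *\<^sub>R v) / t ^ 6) \<longlongrightarrow> C * motzkin (v $ 1) (v $ 2) (v $ 3)) (at_right 0)"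
    and f: "\<And>\<omega>. trig f \<omega> = of_real (\<Phi> \<omega>)" and C: "C \<noteq> 0"
  shows "\<not> sum_hermitian_squares f"
proof
  assume "sum_hermitian_squares f"
  then obtain r :: nat and h where "f = (\<Sum>j<r. laurent_star (h j) * h j)"
    unfolding sum_hermitian_squares_def by blast
  then have "complex_of_real (\<Phi> \<omega>) = of_real (\<Sum>j<r. (cmod (trig (h j) \<omega>))\<^sup>2)" for \<omega>
    unfolding f[symmetric]
    by (simp add: trig_sum trig_mult trig_star complex_norm_square mult.commute del: of_real_power)
  then have eq: "\<Phi> \<omega> = (\<Sum>j<r. (cmod (trig (h j) \<omega>))\<^sup>2)" for \<omega>
    by (simp only: of_real_eq_iff)
  have "(cmod (trig (h j) \<omega>))\<^sup>2 \<le> \<Phi> \<omega>" if "j < r" for j \<omega>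
    unfolding eq by (rule member_le_sum) (use that in auto)
  then have lim: "((\<lambda>t. trig (h j) (t *\<^sub>R axis 3 1) / of_real t ^ 3) \<longlongrightarrow> 0) (at_right 0)" if "j < r" for j
    using hermitian_square_below_motzkin[OF \<Phi>] that by blast
  have "((\<lambda>t. \<Sum>j<r. (cmod (trig (h j) (t *\<^sub>R axis 3 1) / of_real t ^ 3))\<^sup>2) \<longlongrightarrow> (\<Sum>j<r. (cmod 0)\<^sup>2)) (at_right 0)"
    by (intro tendsto_intros lim) auto
  moreover have "(\<Sum>j<r. (cmod (trig (h j) (t *\<^sub>R axis 3 1) / of_real t ^ 3))\<^sup>2) = \<Phi> (t *\<^sub>R axis 3 1) / t ^ 6"
    for t :: real
    by (simp add: eq sum_divide_distrib norm_divide norm_power power_divide flip: power_mult)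
  ultimately have "((\<lambda>t. \<Phi> (t *\<^sub>R axis 3 1) / t ^ 6) \<longlongrightarrow> 0) (at_right 0)" by simp
  with \<Phi>[of "axis 3 1"] have "C * motzkin 0 0 1 = 0"
    by (intro tendsto_unique[of "at_right (0::real)"]) (auto simp: axis_def)
  with C show False by (simp add: motzkin_def)
qed

theorem theorem4p2:
  fixes M :: "int ^ 3 ^ 3"
  assumes "expansive M"
  shows "\<exists>p :: laurent.
    laurent_eval p 1 = 1 \<and>
    (\<forall>z\<in>torus3.
       laurent_eval
         (1 - (\<Sum>\<sigma>\<in>dual_group M. laurent_star (laurent_shift \<sigma> p) * laurent_shift \<sigma> p)) z
       \<in> \<real>\<^sub>\<ge>\<^sub>0) \<and>
    \<not> sum_hermitian_squares (1 - laurent_star p * p)"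
proof -
  define N where "N = nat \<bar>det M\<bar>"
  have N: "N > 0" using expansive_det[OF assms] by (simp add: N_def)
  obtain p where p: "\<And>\<omega>. trig p \<omega> = of_real (motzkin_mask N \<omega>)"
    using is_trig_motzkin_mask unfolding is_trig_def by blast
  have "exp_vec 0 = 1" by (simp add: exp_vec_def vec_eq_iff)
  then have "laurent_eval p 1 = 1"
    using p[of 0] by (simp add: motzkin_mask_0[OF N])
  moreover have "laurent_eval
      (1 - (\<Sum>\<sigma>\<in>dual_group M. laurent_star (laurent_shift \<sigma> p) * laurent_shift \<sigma> p)) z \<in> \<real>\<^sub>\<ge>\<^sub>0"
    if "z \<in> torus3" for z
  proof -
    obtain \<omega> where z: "z = exp_vec \<omega>" using \<open>z \<in> torus3\<close>[folded range_exp_vec] by (rule rangeE)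
    have "\<exists>s. s \<in> \<sigma>" if "\<sigma> \<in> dual_group M" for \<sigma>
      using that in_quotient_imp_non_empty[OF equiv_lattice_rel] by (auto simp: dual_group_def)
    then obtain s where s: "\<And>\<sigma>. \<sigma> \<in> dual_group M \<Longrightarrow> s \<sigma> \<in> \<sigma>" by metis
    have "trig (1 - (\<Sum>\<sigma>\<in>dual_group M. laurent_star (laurent_shift \<sigma> p) * laurent_shift \<sigma> p)) \<omega>
        = of_real (1 - (\<Sum>\<sigma>\<in>dual_group M. (motzkin_mask N (\<omega> + s \<sigma>))\<^sup>2))"
      by (simp add: trig_diff trig_sum trig_mult trig_star trig_shift[OF _ s] p power2_eq_square)
    moreover have "(\<Sum>\<sigma>\<in>dual_group M. (motzkin_mask N (\<omega> + s \<sigma>))\<^sup>2) \<le> 1"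
      unfolding N_def using assms s by (rule motzkin_mask_sub_QMF)
    ultimately show ?thesis
      by (simp only: z nonneg_Reals_of_real_iff diff_ge_0_iff_ge)
  qed
  moreover have "\<not> sum_hermitian_squares (1 - laurent_star p * p)"
  proof (rule not_sum_hermitian_squares_if_motzkin)
    show "((\<lambda>t. (1 - (motzkin_mask N (t *\<^sub>R v))\<^sup>2) / t ^ 6) \<longlongrightarrow> 2 / 3 * motzkin (v $ 1) (v $ 2) (v $ 3)) (at_right 0)" for v
      by (rule motzkin_mask_ray_limit[OF N])
    show "trig (1 - laurent_star p * p) \<omega> = of_real (1 - (motzkin_mask N \<omega>)\<^sup>2)" for \<omega>
      by (simp add: trig_diff trig_mult trig_star p power2_eq_square)
  qed simp
  ultimately show ?thesis by blast
qed

end
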